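(* Let $\mathcal{C}$ be a preregular, finitary extensive category in which every object is projective. A presheaf $F\colon\mathcal{C}^{\mathrm{op}}\to\mathsf{Set}$ is a sheaf for the coherent topology on $\mathcal{C}$ if and only if it preserves finite products.
   Context: A morphism $f\colon Y\to X$ is an effective epimorphism if for every $e\colon Y\to W$ such that $e\circ g_1=e\circ g_2$ for all $g_1,g_2\colon Z\to Y$ with $f\circ g_1=f\circ g_2$, there is a unique $d\colon X\to W$ with $d\circ f=e$. A family of morphisms $(f_i\colon X_i\to B)_{i\in I}$ is effective epimorphic if for every object $W$ and every family $(e_i\colon X_i\to W)_{i\in I}$ such that $e_i\circ g_i=e_j\circ g_j$ whenever $i,j\in I$, $g_i\colon Z\to X_i$, $g_j\colon Z\to X_j$ satisfy $f_i\circ g_i=f_j\circ g_j$, there is a unique $d\colon B\to W$ with $d\circ f_i=e_i$ for all $i$. A category is preregular if for every effective epimorphism $g\colon Z\to Y$ and every morphism $f\colon X\to Y$ there exist an effective epimorphism $h\colon W\to X$ and a morphism $i\colon W\to Z$ with $g\circ i=f\circ h$. A category is finitary extensive if it has finite coproducts, it has pullbacks along coprojections of finite coproducts, and for every commutative diagram with top row $Z_1\to Z\leftarrow Z_2$, bottom row the coprojections $X\to X\coprod Y\leftarrow Y$, and vertical maps $Z_1\to X$, $Z\to X\coprod Y$, $Z_2\to Y$, both squares are pullbacks if and only if the top row is a coproduct diagram. The coherent topology on $\mathcal{C}$ is the smallest Grothendieck topology in which the sieve generated by each finite effective epimorphic family is a covering sieve. (A preregular finitary extensive category is precoherent: the pullback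 of a finite effective epimorphic family along any morphism is refined by a finite effective epimorphic family, so the finite effective epimorphic families form a coverage.) An object $P$ is projective if every morphism out of $P$ lifts along every epimorphism with the same target. A presheaf $F$ preserves finite products if for every finite family $(T_i)_i$ of objects of $\mathcal{C}$ the natural map $F\bigl(\coprod_i T_i\bigr)\to\prod_i F(T_i)$ is a bijection. *)

theory Defs
  imports Main "HOL-Library.FuncSet"
begin

section \<open>Categories\<close>

record ('o, 'm) category =
  Obj :: "'o set"
  Arr :: "'m set"
  Dom :: "'m \<Rightarrow> 'o"
  Cod :: "'m \<Rightarrow> 'o"
  Ident :: "'o \<Rightarrow> 'm"
  Comp :: "'m \<Rightarrow> 'm \<Rightarrow> 'm" (infixl "\<cdot>\<index>" 70)

definition hom :: "('o, 'm) category \<Rightarrow> 'o \<Rightarrow> 'o \<Rightarrow> 'm set" where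
  "hom C X Y = {f \<in> Arr C. Dom C f = X \<and> Cod C f = Y}"

text \<open>Composition is in the usual order: \<open>g \<cdot> f\<close> is ``first \<open>f\<close>, then \<open>g\<close>''.
  Its value on non-composable pairs is irrelevant.\<close>

locale category =
  fixes C :: "('o, 'm) category" (structure)
  assumes Dom_in_Obj: "f \<in> Arr C \<Longrightarrow> Dom C f \<in> Obj C"
    and Cod_in_Obj: "f \<in> Arr C \<Longrightarrow> Cod C f \<in> Obj C"
    and Ident_in_hom: "X \<in> Obj C \<Longrightarrow> Ident C X \<in> hom C X X"
    and Comp_in_hom: "f \<in> hom C X Y \<Longrightarrow> g \<in> hom C Y Z \<Longrightarrow> g \<cdot> f \<in> hom C X Z"
    and Comp_Ident: "f \<in> hom C X Y \<Longrightarrow> f \<cdot> Ident C X = f"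
    and Ident_Comp: "f \<in> hom C X Y \<Longrightarrow> Ident C Y \<cdot> f = f"
    and Comp_assoc: "f \<in> hom C W X \<Longrightarrow> g \<in> hom C X Y \<Longrightarrow> h \<in> hom C Y Z \<Longrightarrow>
      (h \<cdot> g) \<cdot> f = h \<cdot> (g \<cdot> f)"

definition epimorphism :: "('o, 'm) category \<Rightarrow> 'o \<Rightarrow> 'o \<Rightarrow> 'm \<Rightarrow> bool" where
  "epimorphism C Y X f \<longleftrightarrow> f \<in> hom C Y X \<and>
    (\<forall>W. \<forall>d\<in>hom C X W. \<forall>d'\<in>hom C X W. d \<cdot>\<^bsub>C\<^esub> f = d' \<cdot>\<^bsub>C\<^esub> f \<longrightarrow> d = d')"

definition projective :: "('o, 'm) category \<Rightarrow> 'o \<Rightarrow> bool" where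
  "projective C P \<longleftrightarrow> P \<in> Obj C \<and>
    (\<forall>Y X. \<forall>f\<in>hom C P X. \<forall>p. epimorphism C Y X p \<longrightarrow>
      (\<exists>l\<in>hom C P Y. p \<cdot>\<^bsub>C\<^esub> l = f))"

definition effective_epi :: "('o, 'm) category \<Rightarrow> 'o \<Rightarrow> 'o \<Rightarrow> 'm \<Rightarrow> bool" where
  "effective_epi C Y X f \<longleftrightarrow> f \<in> hom C Y X \<and>
    (\<forall>W. \<forall>e\<in>hom C Y W.
      (\<forall>Z. \<forall>g1\<in>hom C Z Y. \<forall>g2\<in>hom C Z Y.
        f \<cdot>\<^bsub>C\<^esub> g1 = f \<cdot>\<^bsub>C\<^esub> g2 \<longrightarrow> e \<cdot>\<^bsub>C\<^esub> g1 = e \<cdot>\<^bsub>C\<^esub> g2) \<longrightarrow>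
      (\<exists>!d. d \<in> hom C X W \<and> d \<cdot>\<^bsub>C\<^esub> f = e))"

definition effective_epi_family ::
  "('o, 'm) category \<Rightarrow> 'i set \<Rightarrow> ('i \<Rightarrow> 'o) \<Rightarrow> 'o \<Rightarrow> ('i \<Rightarrow> 'm) \<Rightarrow> bool" where
  "effective_epi_family C I X B f \<longleftrightarrow> B \<in> Obj C \<and> (\<forall>i\<in>I. f i \<in> hom C (X i) B) \<and>
    (\<forall>W\<in>Obj C. \<forall>e. (\<forall>i\<in>I. e i \<in> hom C (X i) W) \<longrightarrow>
      (\<forall>i\<in>I. \<forall>j\<in>I. \<forall>Z. \<forall>gi\<in>hom C Z (X i). \<forall>gj\<in>hom C Z (X j).
        f i \<cdot>\<^bsub>C\<^esub> gi = f j \<cdot>\<^bsub>C\<^esub> gj \<longrightarrow> e i \<cdot>\<^bsub>C\<^esub> gi = e j \<cdot>\<^bsub>C\<^esub> gj) \<longrightarrow>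
      (\<exists>!d. d \<in> hom C B W \<and> (\<forall>i\<in>I. d \<cdot>\<^bsub>C\<^esub> f i = e i)))"

definition preregular :: "('o, 'm) category \<Rightarrow> bool" where
  "preregular C \<longleftrightarrow>
    (\<forall>X Y Z g f. effective_epi C Z Y g \<and> f \<in> hom C X Y \<longrightarrow>
      (\<exists>W h i. effective_epi C W X h \<and> i \<in> hom C W Z \<and> g \<cdot>\<^bsub>C\<^esub> i = f \<cdot>\<^bsub>C\<^esub> h))"


section \<open>Coproducts, pullbacks, extensivity\<close>

definition is_coproduct ::
  "('o, 'm) category \<Rightarrow> 'i set \<Rightarrow> ('i \<Rightarrow> 'o) \<Rightarrow> 'o \<Rightarrow> ('i \<Rightarrow> 'm) \<Rightarrow> bool" where
  "is_coproduct C I T P \<iota> \<longleftrightarrow> P \<in> Obj C \<and> (\<forall>i\<in>I. \<iota> i \<in> hom C (T i) P) \<and>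
    (\<forall>W\<in>Obj C. \<forall>e. (\<forall>i\<in>I. e i \<in> hom C (T i) W) \<longrightarrow>
      (\<exists>!d. d \<in> hom C P W \<and> (\<forall>i\<in>I. d \<cdot>\<^bsub>C\<^esub> \<iota> i = e i)))"

definition is_binary_coproduct ::
  "('o, 'm) category \<Rightarrow> 'o \<Rightarrow> 'o \<Rightarrow> 'o \<Rightarrow> 'm \<Rightarrow> 'm \<Rightarrow> bool" where
  "is_binary_coproduct C X Y P \<iota>1 \<iota>2 \<longleftrightarrow>
    is_coproduct C UNIV (case_bool X Y) P (case_bool \<iota>1 \<iota>2)"

text \<open>\<open>is_pullback C P X Y B p q f g\<close>: the square with projections \<open>p : P \<rightarrow> X\<close>,
  \<open>q : P \<rightarrow> Y\<close> over \<open>f : X \<rightarrow> B\<close>, \<open>g : Y \<rightarrow> B\<close> is cartesian.\<close>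

definition is_pullback ::
  "('o, 'm) category \<Rightarrow> 'o \<Rightarrow> 'o \<Rightarrow> 'o \<Rightarrow> 'o \<Rightarrow> 'm \<Rightarrow> 'm \<Rightarrow> 'm \<Rightarrow> 'm \<Rightarrow> bool" where
  "is_pullback C P X Y B p q f g \<longleftrightarrow>
    f \<in> hom C X B \<and> g \<in> hom C Y B \<and> p \<in> hom C P X \<and> q \<in> hom C P Y \<and>
    f \<cdot>\<^bsub>C\<^esub> p = g \<cdot>\<^bsub>C\<^esub> q \<and>
    (\<forall>Z. \<forall>u\<in>hom C Z X. \<forall>v\<in>hom C Z Y. f \<cdot>\<^bsub>C\<^esub> u = g \<cdot>\<^bsub>C\<^esub> v \<longrightarrow>
      (\<exists>!w. w \<in> hom C Z P \<and> p \<cdot>\<^bsub>C\<^esub> w = u \<and> q \<cdot>\<^bsub>C\<^esub> w = v))"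

text \<open>Here and below, finite families are indexed by finite sets of natural numbers; up to
  reindexing these are all finite families, including the empty one.\<close>

definition has_finite_coproducts :: "('o, 'm) category \<Rightarrow> bool" where
  "has_finite_coproducts C \<longleftrightarrow>
    (\<forall>(I :: nat set) T. finite I \<and> (\<forall>i\<in>I. T i \<in> Obj C) \<longrightarrow> (\<exists>P \<iota>. is_coproduct C I T P \<iota>))"

definition has_pullbacks_along_coprojections :: "('o, 'm) category \<Rightarrow> bool" where
  "has_pullbacks_along_coprojections C \<longleftrightarrow>
    (\<forall>(I :: nat set) T P \<iota>. finite I \<and> is_coproduct C I T P \<iota> \<longrightarrow>
      (\<forall>i\<in>I. \<forall>Z. \<forall>f\<in>hom C Z P. \<exists>Q p q. is_pullback C Q (T i) Z P p q (\<iota> i) f))"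

definition finitary_extensive :: "('o, 'm) category \<Rightarrow> bool" where
  "finitary_extensive C \<longleftrightarrow>
    has_finite_coproducts C \<and>
    has_pullbacks_along_coprojections C \<and>
    (\<forall>X Y P \<iota>1 \<iota>2 Z1 Z Z2 k1 k2 a1 a a2.
      is_binary_coproduct C X Y P \<iota>1 \<iota>2 \<and>
      k1 \<in> hom C Z1 Z \<and> k2 \<in> hom C Z2 Z \<and>
      a1 \<in> hom C Z1 X \<and> a \<in> hom C Z P \<and> a2 \<in> hom C Z2 Y \<and>
      \<iota>1 \<cdot>\<^bsub>C\<^esub> a1 = a \<cdot>\<^bsub>C\<^esub> k1 \<and> \<iota>2 \<cdot>\<^bsub>C\<^esub> a2 = a \<cdot>\<^bsub>C\<^esub> k2 \<longrightarrow>
      (is_pullback C Z1 X Z P a1 k1 \<iota>1 a \<and> is_pullback C Z2 Y Z P a2 k2 \<iota>2 a \<longleftrightarrow>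
       is_binary_coproduct C Z1 Z2 Z k1 k2))"


section \<open>Sieves and Grothendieck topologies\<close>

definition sieve :: "('o, 'm) category \<Rightarrow> 'o \<Rightarrow> 'm set \<Rightarrow> bool" where
  "sieve C X S \<longleftrightarrow> X \<in> Obj C \<and> (\<forall>f\<in>S. f \<in> Arr C \<and> Cod C f = X) \<and>
    (\<forall>f\<in>S. \<forall>Z. \<forall>g\<in>hom C Z (Dom C f). f \<cdot>\<^bsub>C\<^esub> g \<in> S)"

definition maximal_sieve :: "('o, 'm) category \<Rightarrow> 'o \<Rightarrow> 'm set" where
  "maximal_sieve C X = {f \<in> Arr C. Cod C f = X}"

definition pullback_sieve :: "('o, 'm) category \<Rightarrow> 'm \<Rightarrow> 'm set \<Rightarrow> 'm set" where
  "pullback_sieve C f S = {g \<in> Arr C. Cod C g = Dom C f \<and> f \<cdot>\<^bsub>C\<^esub> g \<in> S}"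

definition generated_sieve ::
  "('o, 'm) category \<Rightarrow> 'i set \<Rightarrow> ('i \<Rightarrow> 'o) \<Rightarrow> ('i \<Rightarrow> 'm) \<Rightarrow> 'm set" where
  "generated_sieve C I X f = {f i \<cdot>\<^bsub>C\<^esub> g | i g. i \<in> I \<and> g \<in> Arr C \<and> Cod C g = X i}"

definition grothendieck_topology :: "('o, 'm) category \<Rightarrow> ('o \<Rightarrow> 'm set set) \<Rightarrow> bool" where
  "grothendieck_topology C J \<longleftrightarrow>
    (\<forall>X. \<forall>S\<in>J X. sieve C X S) \<and>
    (\<forall>X\<in>Obj C. maximal_sieve C X \<in> J X) \<and>
    (\<forall>X Y S. \<forall>f\<in>hom C Y X. S \<in> J X \<longrightarrow> pullback_sieve C f S \<in> J Y) \<and>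
    (\<forall>X S R. S \<in> J X \<and> sieve C X R \<and> (\<forall>f\<in>S. pullback_sieve C f R \<in> J (Dom C f)) \<longrightarrow> R \<in> J X)"

text \<open>The infimum is taken in the pointwise order on \<open>'o \<Rightarrow> 'm set set\<close>; lemma
  \<open>coherent_topology_least\<close> below shows that it is indeed the least such topology.\<close>

definition coherent_topology :: "('o, 'm) category \<Rightarrow> 'o \<Rightarrow> 'm set set" where
  "coherent_topology C = Inf {J. grothendieck_topology C J \<and>
    (\<forall>(I :: nat set) X B f. finite I \<and> effective_epi_family C I X B f \<longrightarrow>
      generated_sieve C I X f \<in> J B)}"


section \<open>Presheaves and sheaves\<close>

record ('o, 'm, 'x) presheaf =
  Sec :: "'o \<Rightarrow> 'x set"
  Res :: "'m \<Rightarrow> 'x \<Rightarrow> 'x"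

text \<open>\<open>Res F f\<close> is only relevant on \<open>Sec F (Cod C f)\<close>.\<close>

locale presheaf = category C for C :: "('o, 'm) category" (structure) +
  fixes F :: "('o, 'm, 'x) presheaf"
  assumes Res_in_Sec: "f \<in> hom C X Y \<Longrightarrow> s \<in> Sec F Y \<Longrightarrow> Res F f s \<in> Sec F X"
    and Res_Ident: "X \<in> Obj C \<Longrightarrow> s \<in> Sec F X \<Longrightarrow> Res F (Ident C X) s = s"
    and Res_Comp: "f \<in> hom C X Y \<Longrightarrow> g \<in> hom C Y Z \<Longrightarrow> s \<in> Sec F Z \<Longrightarrow>
      Res F (g \<cdot> f) s = Res F f (Res F g s)"

definition compatible_family ::
  "('o, 'm) category \<Rightarrow> ('o, 'm, 'x) presheaf \<Rightarrow> 'm set \<Rightarrow> ('m \<Rightarrow> 'x) \<Rightarrow> bool" where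
  "compatible_family C F S x \<longleftrightarrow>
    (\<forall>f\<in>S. x f \<in> Sec F (Dom C f)) \<and>
    (\<forall>f\<in>S. \<forall>Z. \<forall>g\<in>hom C Z (Dom C f). x (f \<cdot>\<^bsub>C\<^esub> g) = Res F g (x f))"

definition is_sheaf ::
  "('o, 'm) category \<Rightarrow> ('o \<Rightarrow> 'm set set) \<Rightarrow> ('o, 'm, 'x) presheaf \<Rightarrow> bool" where
  "is_sheaf C J F \<longleftrightarrow>
    (\<forall>X\<in>Obj C. \<forall>S\<in>J X. \<forall>x. compatible_family C F S x \<longrightarrow>
      (\<exists>!s. s \<in> Sec F X \<and> (\<forall>f\<in>S. Res F f s = x f)))"

text \<open>The condition is imposed for every choice of the coproduct of \<open>(T i)\<^sub>i\<close>. The product of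
  the \<open>Sec F (T i)\<close> is the set of extensional functions on \<open>I\<close>.\<close>

definition preserves_finite_products ::
  "('o, 'm) category \<Rightarrow> ('o, 'm, 'x) presheaf \<Rightarrow> bool" where
  "preserves_finite_products C F \<longleftrightarrow>
    (\<forall>(I :: nat set) T P \<iota>. finite I \<and> (\<forall>i\<in>I. T i \<in> Obj C) \<and> is_coproduct C I T P \<iota> \<longrightarrow>
      bij_betw (\<lambda>s. \<lambda>i\<in>I. Res F (\<iota> i) s) (Sec F P) (\<Pi>\<^sub>E i\<in>I. Sec F (T i)))"


section \<open>The coherent topology is well defined\<close>

context category
begin

lemma sieve_maximal: "X \<in> Obj C \<Longrightarrow> sieve C X (maximal_sieve C X)"
  unfolding sieve_def maximal_sieve_def
proof (intro conjI ballI allI, goal_cases)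
  case (4 f Z g)
  then have "f \<in> hom C (Dom C f) X" "g \<in> hom C Z (Dom C f)" by (simp_all add: hom_def)
  then show ?case using Comp_in_hom by (simp add: hom_def)
qed simp_all

lemma sieve_pullback:
  assumes f: "f \<in> hom C Y X" and S: "sieve C X S"
  shows "sieve C Y (pullback_sieve C f S)"
  unfolding sieve_def
proof (intro conjI ballI allI)
  show "Y \<in> Obj C" using f Dom_in_Obj by (auto simp: hom_def)
  fix g assume g_in: "g \<in> pullback_sieve C f S"
  then have g: "g \<in> hom C (Dom C g) Y" and fg: "f \<cdot> g \<in> S"
    using f by (simp_all add: hom_def pullback_sieve_def)
  then show "g \<in> Arr C" "Cod C g = Y" by (simp_all add: hom_def)
  fix Z h assume h: "h \<in> hom C Z (Dom C g)"
  have "Dom C (f \<cdot> g) = Dom C g" using Comp_in_hom[OF g f] by (simp add: hom_def)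
  then have "(f \<cdot> g) \<cdot> h \<in> S" using S fg h unfolding sieve_def by metis
  then have "f \<cdot> (g \<cdot> h) \<in> S" using Comp_assoc[OF h g f] by simp
  then show "g \<cdot> h \<in> pullback_sieve C f S"
    using Comp_in_hom[OF h g] f by (simp add: pullback_sieve_def hom_def)
qed

lemma sieve_generated:
  assumes "effective_epi_family C I X B f"
  shows "sieve C B (generated_sieve C I X f)"
  unfolding sieve_def
proof (intro conjI ballI allI)
  have fi: "f i \<in> hom C (X i) B" if "i \<in> I" for i
    using assms that by (simp add: effective_epi_family_def)
  show "B \<in> Obj C" using assms by (simp add: effective_epi_family_def)
  fix k assume "k \<in> generated_sieve C I X f"
  then obtain i g where k: "k = f i \<cdot> g" and i: "i \<in> I" and g: "g \<in> hom C (Dom C g) (X i)"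
    by (auto simp: generated_sieve_def hom_def)
  have k_hom: "k \<in> hom C (Dom C g) B" using Comp_in_hom[OF g fi[OF i]] k by simp
  then show "k \<in> Arr C" "Cod C k = B" by (simp_all add: hom_def)
  fix Z h assume "h \<in> hom C Z (Dom C k)"
  then have h: "h \<in> hom C Z (Dom C g)" using k_hom by (simp add: hom_def)
  have "k \<cdot> h = f i \<cdot> (g \<cdot> h)" using Comp_assoc[OF h g fi[OF i]] k by simp
  then show "k \<cdot> h \<in> generated_sieve C I X f"
    using Comp_in_hom[OF h g] i by (auto simp: generated_sieve_def hom_def)
qed

lemma grothendieck_topology_all_sieves: "grothendieck_topology C (\<lambda>X. {S. sieve C X S})"
  unfolding grothendieck_topology_def using sieve_maximal sieve_pullback by auto

lemma coherent_topology_grothendieck: "grothendieck_topology C (coherent_topology C)"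
proof -
  define A where "A = {J. grothendieck_topology C J \<and>
    (\<forall>(I :: nat set) X B f. finite I \<and> effective_epi_family C I X B f \<longrightarrow>
      generated_sieve C I X f \<in> J B)}"
  have top: "(\<lambda>X. {S. sieve C X S}) \<in> A"
    unfolding A_def by (simp add: grothendieck_topology_all_sieves sieve_generated)
  have gt: "grothendieck_topology C J" if "J \<in> A" for J using that by (simp add: A_def)
  have mem: "S \<in> coherent_topology C X \<longleftrightarrow> (\<forall>J\<in>A. S \<in> J X)" for S X
    unfolding coherent_topology_def A_def[symmetric] Inf_apply by simp
  show ?thesis
    unfolding grothendieck_topology_def
  proof (intro conjI ballI allI impI)
    fix X S assume "S \<in> coherent_topology C X"
    then have "S \<in> {S. sieve C X S}" using top unfolding mem by (rule bspec)
    then show "sieve C X S" by simp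
  next
    fix X assume "X \<in> Obj C"
    show "maximal_sieve C X \<in> coherent_topology C X"
      unfolding mem
    proof
      fix J assume "J \<in> A"
      from gt[OF this] show "maximal_sieve C X \<in> J X"
        using \<open>X \<in> Obj C\<close> unfolding grothendieck_topology_def by blast
    qed
  next
    fix X Y S f assume f: "f \<in> hom C Y X" and S: "S \<in> coherent_topology C X"
    show "pullback_sieve C f S \<in> coherent_topology C Y"
      unfolding mem
    proof
      fix J assume J: "J \<in> A"
      then have "S \<in> J X" using S by (simp add: mem)
      then show "pullback_sieve C f S \<in> J Y"
        using gt[OF J] f unfolding grothendieck_topology_def by blast
    qed
  next
    fix X S R
    assume *: "S \<in> coherent_topology C X \<and> sieve C X R \<and>
      (\<forall>f\<in>S. pullback_sieve C f R \<in> coherent_topology C (Dom C f))"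
    show "R \<in> coherent_topology C X"
      unfolding mem
    proof
      fix J assume J: "J \<in> A"
      then have "S \<in> J X" "\<forall>f\<in>S. pullback_sieve C f R \<in> J (Dom C f)"
        using * by (simp_all add: mem)
      then show "R \<in> J X" using gt[OF J] * unfolding grothendieck_topology_def by blast
    qed
  qed
qed

end

lemma generated_sieve_in_coherent_topology:
  fixes I :: "nat set"
  assumes "finite I" "effective_epi_family C I X B f"
  shows "generated_sieve C I X f \<in> coherent_topology C B"
  unfolding coherent_topology_def Inf_apply using assms by simp

lemma coherent_topology_least:
  assumes "grothendieck_topology C J"
    and "\<And>(I :: nat set) X B f. finite I \<Longrightarrow> effective_epi_family C I X B f \<Longrightarrow>
      generated_sieve C I X f \<in> J B"
  shows "coherent_topology C \<le> J"
  unfolding coherent_topology_def by (rule Inf_lower) (use assms in simp)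

end

theory Submission
  imports Defs
begin

text \<open>Under the hypotheses, the coherent topology only sees finite coproduct decompositions. Let
  \<open>(f i : X i \<rightarrow> B)\<close> be a finite effective epimorphic family. The induced map \<open>q\<close> from the
  coproduct of the \<open>X i\<close> to \<open>B\<close> is an epimorphism, and since \<open>B\<close> is projective it has a section.
  Extensivity pulls the coproduct back along this section to a decomposition of \<open>B\<close> each of
  whose coprojections factors through some \<open>f i\<close>. So the sieve generated by the family contains
  the coprojections of a finite coproduct decomposition of \<open>B\<close>
  (\<open>generated_sieve_in_decomposition_topology\<close>).

  The sieves with this property form a Grothendieck topology
  (\<open>decomposition_topology_grothendieck\<close>): decompositions can be pulled back
  (\<open>coproduct_pullback\<close>) and refined (\<open>coproduct_Sigma\<close>). It thus contains the coherent topology.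
  A presheaf that preserves finite products is a sheaf for it: sections over the summands of a
  decomposition of \<open>X\<close> are the same as a section over \<open>X\<close> (\<open>product_preserving_sheaf\<close>).

  Conversely, the coprojections of a finite coproduct are an effective epimorphic family, so a
  coherent sheaf sends the coproduct to the set of compatible families on its summands. In an
  extensive category coprojections are monomorphisms (\<open>coprojection_mono\<close>) and pairwise disjoint
  (\<open>coprojections_disjoint\<close>), and a sheaf has at most one section over an initial object, which is
  covered by the empty sieve. So every family of sections over the summands is compatible
  (\<open>sheaf_product_preserving\<close>).\<close>


section \<open>Coproducts in a category\<close>

context category
begin

lemma hom_Obj: "f \<in> hom C X Y \<Longrightarrow> X \<in> Obj C \<and> Y \<in> Obj C"
  using Dom_in_Obj Cod_in_Obj by (auto simp: hom_def)

lemma coproductI: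
  assumes "P \<in> Obj C" "\<And>i. i \<in> I \<Longrightarrow> \<iota> i \<in> hom C (T i) P"
    and "\<And>W e. W \<in> Obj C \<Longrightarrow> (\<And>i. i \<in> I \<Longrightarrow> e i \<in> hom C (T i) W) \<Longrightarrow>
      \<exists>d\<in>hom C P W. \<forall>i\<in>I. d \<cdot> \<iota> i = e i"
    and "\<And>W d d'. d \<in> hom C P W \<Longrightarrow> d' \<in> hom C P W \<Longrightarrow>
      (\<And>i. i \<in> I \<Longrightarrow> d \<cdot> \<iota> i = d' \<cdot> \<iota> i) \<Longrightarrow> d = d'"
  shows "is_coproduct C I T P \<iota>"
  unfolding is_coproduct_def
proof (intro conjI ballI allI impI)
  fix W e assume "W \<in> Obj C" "\<forall>i\<in>I. e i \<in> hom C (T i) W"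
  then obtain d where d: "d \<in> hom C P W" "\<forall>i\<in>I. d \<cdot> \<iota> i = e i" using assms(3)[of W e] by blast
  show "\<exists>!d. d \<in> hom C P W \<and> (\<forall>i\<in>I. d \<cdot> \<iota> i = e i)"
  proof (rule ex1I[of _ d])
    show "d' = d" if "d' \<in> hom C P W \<and> (\<forall>i\<in>I. d' \<cdot> \<iota> i = e i)" for d'
      by (rule assms(4)) (use that d in simp_all)
  qed (use d in simp)
qed (use assms(1,2) in auto)

lemma coproduct_inj: "is_coproduct C I T P \<iota> \<Longrightarrow> i \<in> I \<Longrightarrow> \<iota> i \<in> hom C (T i) P"
  by (simp add: is_coproduct_def)

lemma coproduct_universal:
  assumes "is_coproduct C I T P \<iota>" "W \<in> Obj C" "\<And>i. i \<in> I \<Longrightarrow> e i \<in> hom C (T i) W"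
  shows "\<exists>!d. d \<in> hom C P W \<and> (\<forall>i\<in>I. d \<cdot> \<iota> i = e i)"
  by (rule assms(1)[unfolded is_coproduct_def, THEN conjunct2, THEN conjunct2, rule_format])
    (rule assms(2), rule assms(3))

lemma coproduct_desc:
  assumes "is_coproduct C I T P \<iota>" "W \<in> Obj C" "\<And>i. i \<in> I \<Longrightarrow> e i \<in> hom C (T i) W"
  obtains d where "d \<in> hom C P W" "\<And>i. i \<in> I \<Longrightarrow> d \<cdot> \<iota> i = e i"
  using ex1_implies_ex[OF coproduct_universal[of I T P \<iota> W e, OF assms]] by blast

lemma coproduct_ext:
  assumes P: "is_coproduct C I T P \<iota>" and d: "d \<in> hom C P W" "d' \<in> hom C P W"
    and eq: "\<And>i. i \<in> I \<Longrightarrow> d \<cdot> \<iota> i = d' \<cdot> \<iota> i"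
  shows "d = d'"
proof -
  have W: "W \<in> Obj C" using hom_Obj[OF d(1)] by simp
  have dW: "d \<cdot> \<iota> i \<in> hom C (T i) W" if "i \<in> I" for i
    using Comp_in_hom[OF coproduct_inj[OF P that] d(1)] .
  show ?thesis
  proof (rule ex1E[OF coproduct_universal[of I T P \<iota> W "\<lambda>i. d \<cdot> \<iota> i", OF P W dW]])
    fix k assume "\<forall>c. c \<in> hom C P W \<and> (\<forall>i\<in>I. c \<cdot> \<iota> i = d \<cdot> \<iota> i) \<longrightarrow> c = k"
    note k = this[rule_format, OF conjI]
    have "d = k" by (rule k) (simp_all add: d)
    moreover have "d' = k" by (rule k) (simp_all add: d eq)
    ultimately show ?thesis by simp
  qed
qed

lemma coproduct_cong:
  assumes "\<And>i. i \<in> I \<Longrightarrow> T i = T' i" "\<And>i. i \<in> I \<Longrightarrow> \<iota> i = \<iota>' i"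
  shows "is_coproduct C I T P \<iota> \<longleftrightarrow> is_coproduct C I T' P \<iota>'"
  using assms unfolding is_coproduct_def by simp

lemma coproduct_reindex:
  assumes h: "bij_betw h I J" and P: "is_coproduct C J T P \<iota>"
  shows "is_coproduct C I (T \<circ> h) P (\<iota> \<circ> h)"
proof (rule coproductI)
  have hJ: "h i \<in> J" if "i \<in> I" for i using h that by (auto simp: bij_betw_def)
  show "P \<in> Obj C" using P by (simp add: is_coproduct_def)
  show "(\<iota> \<circ> h) i \<in> hom C ((T \<circ> h) i) P" if "i \<in> I" for i
    using coproduct_inj[OF P hJ[OF that]] by simp
  fix W
  {
    fix e assume W: "W \<in> Obj C" and e: "\<And>i. i \<in> I \<Longrightarrow> e i \<in> hom C ((T \<circ> h) i) W"
    define e' where "e' j = e (inv_into I h j)" for j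
    have "e' j \<in> hom C (T j) W" if "j \<in> J" for j
      using e[of "inv_into I h j"] that h unfolding e'_def bij_betw_def
      by (metis comp_apply f_inv_into_f inv_into_into)
    from coproduct_desc[OF P W this] obtain d
      where d: "d \<in> hom C P W" "\<And>j. j \<in> J \<Longrightarrow> d \<cdot> \<iota> j = e' j" by blast
    have "e' (h i) = e i" if "i \<in> I" for i using h that by (simp add: e'_def bij_betw_def)
    then show "\<exists>d\<in>hom C P W. \<forall>i\<in>I. d \<cdot> (\<iota> \<circ> h) i = e i"
      by (intro bexI[of _ d] ballI) (simp_all add: d hJ)
  }
  fix d d' assume d: "d \<in> hom C P W" "d' \<in> hom C P W"
    and eq: "\<And>i. i \<in> I \<Longrightarrow> d \<cdot> (\<iota> \<circ> h) i = d' \<cdot> (\<iota> \<circ> h) i"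
  have "d \<cdot> \<iota> j = d' \<cdot> \<iota> j" if "j \<in> J" for j using eq h that by (auto simp: bij_betw_def)
  then show "d = d'" by (rule coproduct_ext[OF P d])
qed

lemma coproduct_singleton:
  assumes "X \<in> Obj C"
  shows "is_coproduct C {i} (\<lambda>_. X) X (\<lambda>_. Ident C X)"
proof (rule coproductI)
  show "\<exists>d\<in>hom C X W. \<forall>i\<in>{i}. d \<cdot> Ident C X = e i" if "\<And>j. j \<in> {i} \<Longrightarrow> e j \<in> hom C X W" for e W
    using that[of i] Comp_Ident[OF that[of i]] by (intro bexI[of _ "e i"]) simp_all
  show "d = d'" if "d \<in> hom C X W" "d' \<in> hom C X W"
      "\<And>j. j \<in> {i} \<Longrightarrow> d \<cdot> Ident C X = d' \<cdot> Ident C X" for d d' W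
    using that(3)[of i] Comp_Ident[OF that(1)] Comp_Ident[OF that(2)] by simp
  show "X \<in> Obj C" by fact
  show "Ident C X \<in> hom C X X" using Ident_in_hom[OF assms] .
qed

text \<open>A cocone on the \<open>Q a\<close> is the same thing as a cocone on all the \<open>T a b\<close>, because each
  \<open>Q a\<close> is a coproduct. Hence a coproduct may be formed, or taken apart, in two stages.\<close>

lemma coproduct_Sigma:
  assumes Q: "\<And>a. a \<in> A \<Longrightarrow> is_coproduct C (B a) (T a) (Q a) (\<kappa> a)"
    and \<iota>: "\<And>a. a \<in> A \<Longrightarrow> \<iota> a \<in> hom C (Q a) P"
  shows "is_coproduct C A Q P \<iota> \<longleftrightarrow>
    is_coproduct C (Sigma A B) (\<lambda>(a, b). T a b) P (\<lambda>(a, b). \<iota> a \<cdot> \<kappa> a b)"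
proof
  assume P: "is_coproduct C A Q P \<iota>"
  show "is_coproduct C (Sigma A B) (\<lambda>(a, b). T a b) P (\<lambda>(a, b). \<iota> a \<cdot> \<kappa> a b)"
  proof (rule coproductI)
    show "P \<in> Obj C" using P by (simp add: is_coproduct_def)
    show "(case i of (a, b) \<Rightarrow> \<iota> a \<cdot> \<kappa> a b) \<in> hom C (case i of (a, b) \<Rightarrow> T a b) P"
      if "i \<in> Sigma A B" for i
      using that coproduct_inj[OF Q] \<iota> Comp_in_hom by fastforce
    fix W
    {
      fix e assume W: "W \<in> Obj C"
        and e: "\<And>i. i \<in> Sigma A B \<Longrightarrow> e i \<in> hom C (case i of (a, b) \<Rightarrow> T a b) W"
      have "\<exists>c\<in>hom C (Q a) W. \<forall>b\<in>B a. c \<cdot> \<kappa> a b = e (a, b)" if "a \<in> A" for a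
        using coproduct_desc[OF Q[OF that] W, of "\<lambda>b. e (a, b)"] e that
        by (metis (no_types, lifting) SigmaI case_prod_conv)
      then obtain c where c: "\<And>a. a \<in> A \<Longrightarrow> c a \<in> hom C (Q a) W"
        "\<And>a b. a \<in> A \<Longrightarrow> b \<in> B a \<Longrightarrow> c a \<cdot> \<kappa> a b = e (a, b)" by metis
      from coproduct_desc[OF P W c(1)] obtain d
        where d: "d \<in> hom C P W" "\<And>a. a \<in> A \<Longrightarrow> d \<cdot> \<iota> a = c a" by blast
      have "d \<cdot> (\<iota> a \<cdot> \<kappa> a b) = e (a, b)" if "a \<in> A" "b \<in> B a" for a b
        using Comp_assoc[OF coproduct_inj[OF Q[OF that(1)] that(2)] \<iota>[OF that(1)] d(1)] d(2) c(2) that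
        by simp
      then show "\<exists>d\<in>hom C P W. \<forall>i\<in>Sigma A B. d \<cdot> (case i of (a, b) \<Rightarrow> \<iota> a \<cdot> \<kappa> a b) = e i"
        using d(1) by auto
    }
    fix d d' assume d: "d \<in> hom C P W" "d' \<in> hom C P W" and eq: "\<And>i. i \<in> Sigma A B \<Longrightarrow>
      d \<cdot> (case i of (a, b) \<Rightarrow> \<iota> a \<cdot> \<kappa> a b) = d' \<cdot> (case i of (a, b) \<Rightarrow> \<iota> a \<cdot> \<kappa> a b)"
    show "d = d'"
    proof (rule coproduct_ext[OF P d])
      fix a assume a: "a \<in> A"
      show "d \<cdot> \<iota> a = d' \<cdot> \<iota> a"
      proof (rule coproduct_ext[OF Q[OF a]])
        fix b assume b: "b \<in> B a"
        note k = coproduct_inj[OF Q[OF a] b]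
        show "(d \<cdot> \<iota> a) \<cdot> \<kappa> a b = (d' \<cdot> \<iota> a) \<cdot> \<kappa> a b"
          using eq[of "(a, b)"] a b Comp_assoc[OF k \<iota>[OF a] d(1)] Comp_assoc[OF k \<iota>[OF a] d(2)]
          by simp
      qed (use \<iota>[OF a] d Comp_in_hom in blast)+
    qed
  qed
next
  assume P: "is_coproduct C (Sigma A B) (\<lambda>(a, b). T a b) P (\<lambda>(a, b). \<iota> a \<cdot> \<kappa> a b)"
  show "is_coproduct C A Q P \<iota>"
  proof (rule coproductI)
    show "P \<in> Obj C" using P by (simp add: is_coproduct_def)
    fix W
    {
      fix e assume W: "W \<in> Obj C" and e: "\<And>a. a \<in> A \<Longrightarrow> e a \<in> hom C (Q a) W"
      have "(case i of (a, b) \<Rightarrow> e a \<cdot> \<kappa> a b) \<in> hom C (case i of (a, b) \<Rightarrow> T a b) W"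
        if "i \<in> Sigma A B" for i
        using that coproduct_inj[OF Q] e Comp_in_hom by fastforce
      from coproduct_desc[OF P W this] obtain d where d: "d \<in> hom C P W"
        and d': "\<And>i. i \<in> Sigma A B \<Longrightarrow> d \<cdot> (case i of (a, b) \<Rightarrow> \<iota> a \<cdot> \<kappa> a b) =
          (case i of (a, b) \<Rightarrow> e a \<cdot> \<kappa> a b)" by blast
      have "d \<cdot> \<iota> a = e a" if a: "a \<in> A" for a
      proof (rule coproduct_ext[OF Q[OF a] _ e[OF a]])
        show "d \<cdot> \<iota> a \<in> hom C (Q a) W" using Comp_in_hom[OF \<iota>[OF a] d] .
        fix b assume b: "b \<in> B a"
        show "(d \<cdot> \<iota> a) \<cdot> \<kappa> a b = e a \<cdot> \<kappa> a b"
          using d'[of "(a, b)"] a b Comp_assoc[OF coproduct_inj[OF Q[OF a] b] \<iota>[OF a] d] by simp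
      qed
      then show "\<exists>d\<in>hom C P W. \<forall>a\<in>A. d \<cdot> \<iota> a = e a" using d by blast
    }
    fix d d' assume d: "d \<in> hom C P W" "d' \<in> hom C P W"
      and eq: "\<And>a. a \<in> A \<Longrightarrow> d \<cdot> \<iota> a = d' \<cdot> \<iota> a"
    show "d = d'"
    proof (rule coproduct_ext[OF P d])
      fix i assume "i \<in> Sigma A B"
      then obtain a b where i: "i = (a, b)" and a: "a \<in> A" and b: "b \<in> B a" by blast
      note k = coproduct_inj[OF Q[OF a] b]
      show "d \<cdot> (case i of (a, b) \<Rightarrow> \<iota> a \<cdot> \<kappa> a b) = d' \<cdot> (case i of (a, b) \<Rightarrow> \<iota> a \<cdot> \<kappa> a b)"
        using Comp_assoc[OF k \<iota>[OF a] d(1)] Comp_assoc[OF k \<iota>[OF a] d(2)] eq[OF a] i by simp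
    qed
  qed (rule \<iota>)
qed

lemma binary_coproductD:
  assumes "is_binary_coproduct C X Y P \<iota>1 \<iota>2"
  shows "\<iota>1 \<in> hom C X P" "\<iota>2 \<in> hom C Y P"
  using coproduct_inj[OF assms[unfolded is_binary_coproduct_def], of True]
    coproduct_inj[OF assms[unfolded is_binary_coproduct_def], of False] by simp_all

lemma binary_coproductI:
  assumes "\<iota>1 \<in> hom C X P" "\<iota>2 \<in> hom C Y P"
    and "\<And>W e1 e2. e1 \<in> hom C X W \<Longrightarrow> e2 \<in> hom C Y W \<Longrightarrow>
      \<exists>d\<in>hom C P W. d \<cdot> \<iota>1 = e1 \<and> d \<cdot> \<iota>2 = e2"
    and "\<And>W d d'. d \<in> hom C P W \<Longrightarrow> d' \<in> hom C P W \<Longrightarrow>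
      d \<cdot> \<iota>1 = d' \<cdot> \<iota>1 \<Longrightarrow> d \<cdot> \<iota>2 = d' \<cdot> \<iota>2 \<Longrightarrow> d = d'"
  shows "is_binary_coproduct C X Y P \<iota>1 \<iota>2"
  unfolding is_binary_coproduct_def
proof (rule coproductI)
  show "P \<in> Obj C" using hom_Obj assms(1) by blast
  show "case_bool \<iota>1 \<iota>2 b \<in> hom C (case_bool X Y b) P" for b using assms(1,2) by (cases b) simp_all
  fix W
  show "\<exists>d\<in>hom C P W. \<forall>b\<in>UNIV. d \<cdot> case_bool \<iota>1 \<iota>2 b = e b"
    if "\<And>b. b \<in> UNIV \<Longrightarrow> e b \<in> hom C (case_bool X Y b) W" for e
    using assms(3)[of "e True" W "e False"] that[of True] that[of False] by (auto split: bool.split)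
  show "d = d'" if "d \<in> hom C P W" "d' \<in> hom C P W"
    "\<And>b. b \<in> UNIV \<Longrightarrow> d \<cdot> case_bool \<iota>1 \<iota>2 b = d' \<cdot> case_bool \<iota>1 \<iota>2 b" for d d'
    using assms(4)[OF that(1,2)] that(3)[of True] that(3)[of False] by simp
qed

text \<open>The inductive step for finite coproducts: the instance of \<open>coproduct_Sigma\<close> for two summands,
  of which the first is itself a coproduct with one summand.\<close>

lemma coproduct_insert_iff:
  assumes i: "i \<notin> I" and Q: "is_coproduct C I T Q \<kappa>"
    and \<iota>1: "\<iota>1 \<in> hom C (T i) P" and \<iota>2: "\<iota>2 \<in> hom C Q P"
  shows "is_binary_coproduct C (T i) Q P \<iota>1 \<iota>2 \<longleftrightarrow>
    is_coproduct C (insert i I) T P (\<lambda>j. if j = i then \<iota>1 else \<iota>2 \<cdot> \<kappa> j)"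
proof -
  let ?B = "case_bool {i} I"
  let ?k = "\<lambda>(b::bool) j. if b then Ident C (T i) else \<kappa> j"
  let ?h = "\<lambda>j. (j = i, j)"
  let ?T = "\<lambda>(b::bool, j). T j" and ?\<iota> = "\<lambda>(b, j). case_bool \<iota>1 \<iota>2 b \<cdot> ?k b j"
  have Ti: "T i \<in> Obj C" using hom_Obj[OF \<iota>1] by simp
  have S: "is_binary_coproduct C (T i) Q P \<iota>1 \<iota>2 \<longleftrightarrow> is_coproduct C (Sigma UNIV ?B) ?T P ?\<iota>"
    unfolding is_binary_coproduct_def
  proof (rule coproduct_Sigma)
    show "is_coproduct C (?B b) T (case_bool (T i) Q b) (?k b)" for b
    proof (cases b)
      case True
      then show ?thesis
        using coproduct_singleton[OF Ti, of i]
          coproduct_cong[of "{i}" T "\<lambda>_. T i" "\<lambda>_. Ident C (T i)" "\<lambda>_. Ident C (T i)"] by simp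
    qed (use Q in simp)
    show "case_bool \<iota>1 \<iota>2 b \<in> hom C (case_bool (T i) Q b) P" for b using \<iota>1 \<iota>2 by (cases b) simp_all
  qed
  have h: "bij_betw ?h (insert i I) (Sigma UNIV ?B)"
    by (rule bij_betwI[where g = snd]) (use i in \<open>auto split: bool.splits if_splits\<close>)
  have h': "bij_betw snd (Sigma UNIV ?B) (insert i I)"
    by (rule bij_betwI[where g = ?h]) (use i in \<open>auto split: bool.splits if_splits\<close>)
  let ?e = "\<lambda>j. if j = i then \<iota>1 else \<iota>2 \<cdot> \<kappa> j"
  have "is_coproduct C (Sigma UNIV ?B) ?T P ?\<iota> \<longleftrightarrow> is_coproduct C (insert i I) T P ?e"
  proof
    assume "is_coproduct C (Sigma UNIV ?B) ?T P ?\<iota>"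
    from coproduct_reindex[OF h this] show "is_coproduct C (insert i I) T P ?e"
      by (subst coproduct_cong[of _ _ "?T \<circ> ?h" _ "?\<iota> \<circ> ?h"]) (auto simp: Comp_Ident[OF \<iota>1])
  next
    assume "is_coproduct C (insert i I) T P ?e"
    from coproduct_reindex[OF h' this] show "is_coproduct C (Sigma UNIV ?B) ?T P ?\<iota>"
      by (subst coproduct_cong[of _ _ "T \<circ> snd" _ "?e \<circ> snd"])
        (use i in \<open>auto simp: Comp_Ident[OF \<iota>1] split: bool.splits if_splits\<close>)
  qed
  then show ?thesis using S by simp
qed

lemma pullback_lift:
  assumes "is_pullback C P X Y B p q f g" "u \<in> hom C Z X" "v \<in> hom C Z Y" "f \<cdot> u = g \<cdot> v"
  shows "\<exists>w\<in>hom C Z P. p \<cdot> w = u \<and> q \<cdot> w = v"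
proof -
  have "\<exists>!w. w \<in> hom C Z P \<and> p \<cdot> w = u \<and> q \<cdot> w = v"
    using assms unfolding is_pullback_def by simp
  then show ?thesis by blast
qed

text \<open>The universal property of a coproduct glues every family \<open>e\<close>, in particular the compatible
  ones.\<close>

lemma coproduct_effective_epi_family:
  "is_coproduct C I T P \<iota> \<Longrightarrow> effective_epi_family C I T P \<iota>"
  unfolding is_coproduct_def effective_epi_family_def by blast

lemma sieve_Comp: "sieve C X S \<Longrightarrow> f \<in> S \<Longrightarrow> f \<in> hom C Y X \<Longrightarrow> g \<in> hom C Z Y \<Longrightarrow> f \<cdot> g \<in> S"
  by (auto simp: sieve_def hom_def)

end


section \<open>Finite coproducts in a finitary extensive category\<close>

locale extensive_category = category +
  assumes extensive: "finitary_extensive C"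
begin

lemma finite_coproduct_exists:
  fixes I :: "nat set"
  assumes "finite I" "\<And>i. i \<in> I \<Longrightarrow> T i \<in> Obj C"
  obtains P \<iota> where "is_coproduct C I T P \<iota>"
  using assms extensive unfolding finitary_extensive_def has_finite_coproducts_def by metis

lemma extensive_iff:
  assumes "is_binary_coproduct C X Y P \<iota>1 \<iota>2"
    and "k1 \<in> hom C Z1 Z" "k2 \<in> hom C Z2 Z"
    and "a1 \<in> hom C Z1 X" "a \<in> hom C Z P" "a2 \<in> hom C Z2 Y"
    and "\<iota>1 \<cdot> a1 = a \<cdot> k1" "\<iota>2 \<cdot> a2 = a \<cdot> k2"
  shows "is_pullback C Z1 X Z P a1 k1 \<iota>1 a \<and> is_pullback C Z2 Y Z P a2 k2 \<iota>2 a \<longleftrightarrow>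
    is_binary_coproduct C Z1 Z2 Z k1 k2"
  using extensive assms unfolding finitary_extensive_def by blast

lemma initial_exists:
  obtains O' where "\<And>T \<iota>. is_coproduct C ({} :: nat set) T O' \<iota>"
proof -
  obtain P \<iota> where "is_coproduct C ({} :: nat set) (\<lambda>_. undefined) P \<iota>"
    by (rule finite_coproduct_exists[of "{}"]) auto
  then have "is_coproduct C ({} :: nat set) T P \<iota>'" for T \<iota>' by (simp add: is_coproduct_def)
  then show ?thesis by (rule that)
qed

text \<open>Extensivity applied to the coproduct \<open>X = X \<squnion> 0\<close> lying over \<open>X \<squnion> Y\<close> through the first
  coprojection: its two squares are the kernel pair of that coprojection, which is thus trivial, and
  its intersection with the other coprojection, which is thus the initial object.\<close>

lemma binary_coprojections:
  assumes P: "is_binary_coproduct C X Y P \<iota>1 \<iota>2"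
    and O': "is_coproduct C ({} :: nat set) T O' \<kappa>"
  shows "\<And>Z g h. g \<in> hom C Z X \<Longrightarrow> h \<in> hom C Z X \<Longrightarrow> \<iota>1 \<cdot> g = \<iota>1 \<cdot> h \<Longrightarrow> g = h"
    and "\<And>Z g h. g \<in> hom C Z X \<Longrightarrow> h \<in> hom C Z Y \<Longrightarrow> \<iota>1 \<cdot> g = \<iota>2 \<cdot> h \<Longrightarrow>
      \<exists>w. w \<in> hom C Z O'"
proof -
  note \<iota> = binary_coproductD[OF P]
  have X: "X \<in> Obj C" and Y: "Y \<in> Obj C" using \<iota> hom_Obj by blast+
  \<comment> \<open>On the empty family anything is a cocone, \<open>undefined\<close> included.\<close>
  obtain x where x: "x \<in> hom C O' X" using coproduct_desc[OF O' X, of undefined] by blast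
  obtain y where y: "y \<in> hom C O' Y" using coproduct_desc[OF O' Y, of undefined] by blast
  note uniq = coproduct_ext[OF O', simplified]
  have "is_binary_coproduct C X O' X (Ident C X) x"
  proof (rule binary_coproductI)
    show "\<exists>d\<in>hom C X W. d \<cdot> Ident C X = e1 \<and> d \<cdot> x = e2"
      if "e1 \<in> hom C X W" "e2 \<in> hom C O' W" for W e1 e2
      using that Comp_Ident[OF that(1)] uniq[OF Comp_in_hom[OF x that(1)] that(2)] by blast
    show "d = d'" if "d \<in> hom C X W" "d' \<in> hom C X W" "d \<cdot> Ident C X = d' \<cdot> Ident C X" for W d d'
      using that(3) Comp_Ident[OF that(1)] Comp_Ident[OF that(2)] by simp
  qed (rule Ident_in_hom[OF X], rule x)
  moreover have "\<iota>2 \<cdot> y = \<iota>1 \<cdot> x"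
    by (rule uniq[OF Comp_in_hom[OF y \<iota>(2)] Comp_in_hom[OF x \<iota>(1)]])
  ultimately have pb: "is_pullback C X X X P (Ident C X) (Ident C X) \<iota>1 \<iota>1"
    "is_pullback C O' Y X P y x \<iota>2 \<iota>1"
    using extensive_iff[OF P Ident_in_hom[OF X] x Ident_in_hom[OF X] \<iota>(1) y refl] by blast+
  show "g = h" if "g \<in> hom C Z X" "h \<in> hom C Z X" "\<iota>1 \<cdot> g = \<iota>1 \<cdot> h" for Z g h
    using pullback_lift[OF pb(1) that] by auto
  show "\<exists>w. w \<in> hom C Z O'" if "g \<in> hom C Z X" "h \<in> hom C Z Y" "\<iota>1 \<cdot> g = \<iota>2 \<cdot> h" for Z g h
    using pullback_lift[OF pb(2) that(2,1) that(3)[symmetric]] by blast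
qed

text \<open>A map \<open>w : Z \<rightarrow> 0\<close> makes \<open>Z\<close> initial: pulling back \<open>0 = 0 \<squnion> 0\<close> (both coprojections identities)
  along \<open>w\<close> shows that \<open>Z\<close> is the coproduct of two copies of itself with identity coprojections,
  so that any two parallel maps out of \<open>Z\<close> agree.\<close>

lemma initial_strict:
  assumes O': "is_coproduct C ({} :: nat set) T O' \<kappa>" and w: "w \<in> hom C Z O'"
  shows "is_coproduct C ({} :: nat set) T' Z \<kappa>'"
proof -
  have Z: "Z \<in> Obj C" and OO: "O' \<in> Obj C" using w hom_Obj by blast+
  note uniq = coproduct_ext[OF O', simplified]
  let ?z = "Ident C Z" and ?o = "Ident C O'"
  note z = Ident_in_hom[OF Z] and o = Ident_in_hom[OF OO]
  have O2: "is_binary_coproduct C O' O' O' ?o ?o"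
  proof (rule binary_coproductI[OF o o])
    show "\<exists>d\<in>hom C O' W. d \<cdot> ?o = e1 \<and> d \<cdot> ?o = e2"
      if "e1 \<in> hom C O' W" "e2 \<in> hom C O' W" for W e1 e2
      using that Comp_Ident[OF that(1)] uniq[OF that] by blast
    show "d = d'" if "d \<in> hom C O' W" "d' \<in> hom C O' W" for W d d' by (rule uniq[OF that])
  qed
  have sq: "?o \<cdot> w = w \<cdot> ?z" using Ident_Comp[OF w] Comp_Ident[OF w] by simp
  have "is_pullback C Z O' Z O' w ?z ?o w"
    unfolding is_pullback_def
  proof (intro conjI allI ballI impI)
    fix Z' u v assume u: "u \<in> hom C Z' O'" and v: "v \<in> hom C Z' Z" and uv: "?o \<cdot> u = w \<cdot> v"
    show "\<exists>!m. m \<in> hom C Z' Z \<and> w \<cdot> m = u \<and> ?z \<cdot> m = v"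
    proof (rule ex1I[of _ v])
      show "v \<in> hom C Z' Z \<and> w \<cdot> v = u \<and> ?z \<cdot> v = v" using v uv Ident_Comp[OF u] Ident_Comp[OF v] by simp
      show "m = v" if "m \<in> hom C Z' Z \<and> w \<cdot> m = u \<and> ?z \<cdot> m = v" for m
        using that Ident_Comp[of m Z' Z] by metis
    qed
  qed (rule o w z sq)+
  then have B: "is_binary_coproduct C Z Z Z ?z ?z"
    using extensive_iff[OF O2 z z w w w sq sq] by blast
  have eq: "d = d'" if d: "d \<in> hom C Z W" "d' \<in> hom C Z W" for d d' W
  proof -
    have W: "W \<in> Obj C" using hom_Obj[OF d(1)] by simp
    have "case_bool d d' b \<in> hom C (case_bool Z Z b) W" for b using d by (cases b) simp_all
    from coproduct_desc[OF B[unfolded is_binary_coproduct_def] W this] obtain m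
      where m: "\<And>b. b \<in> UNIV \<Longrightarrow> m \<cdot> case_bool ?z ?z b = case_bool d d' b" by blast
    show ?thesis using m[of True] m[of False] by simp
  qed
  show ?thesis
  proof (rule coproductI)
    show "\<exists>d\<in>hom C Z W. \<forall>i\<in>{}. d \<cdot> \<kappa>' i = e i" if W: "W \<in> Obj C" for W e
    proof -
      obtain d where "d \<in> hom C O' W" using coproduct_desc[OF O' W, of undefined] by blast
      from Comp_in_hom[OF w this] show ?thesis by (intro bexI) simp_all
    qed
    show "d = d'" if "d \<in> hom C Z W" "d' \<in> hom C Z W" for W d d' by (rule eq[OF that])
  qed (simp_all add: Z)
qed

lemma coproduct_split:
  fixes I :: "nat set"
  assumes I: "finite I" "i \<notin> I" and P: "is_coproduct C (insert i I) T P \<iota>"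
  obtains Q \<kappa> \<iota>2 where "is_coproduct C I T Q \<kappa>" "is_binary_coproduct C (T i) Q P (\<iota> i) \<iota>2"
    "\<And>j. j \<in> I \<Longrightarrow> \<iota>2 \<cdot> \<kappa> j = \<iota> j"
proof -
  have \<iota>: "\<iota> j \<in> hom C (T j) P" if "j \<in> insert i I" for j using coproduct_inj[OF P that] .
  have "T j \<in> Obj C" if "j \<in> I" for j using \<iota> that hom_Obj by blast
  then obtain Q \<kappa> where Q: "is_coproduct C I T Q \<kappa>" using finite_coproduct_exists[OF I(1)] by metis
  have "P \<in> Obj C" using P by (simp add: is_coproduct_def)
  from coproduct_desc[OF Q this] \<iota> obtain \<iota>2
    where \<iota>2: "\<iota>2 \<in> hom C Q P" "\<And>j. j \<in> I \<Longrightarrow> \<iota>2 \<cdot> \<kappa> j = \<iota> j" by (metis insertI2)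
  have "is_coproduct C (insert i I) T P (\<lambda>j. if j = i then \<iota> i else \<iota>2 \<cdot> \<kappa> j)"
    by (subst coproduct_cong[of _ _ T _ \<iota>]) (use P \<iota>2 in auto)
  then have "is_binary_coproduct C (T i) Q P (\<iota> i) \<iota>2"
    using coproduct_insert_iff[of i I T Q \<kappa>, OF I(2) Q \<iota> \<iota>2(1)] by simp
  with Q \<iota>2(2) show ?thesis using that by blast
qed

lemma coprojection_mono:
  fixes I :: "nat set"
  assumes "finite I" "is_coproduct C I T P \<iota>" "i \<in> I"
    and "g \<in> hom C Z (T i)" "h \<in> hom C Z (T i)" "\<iota> i \<cdot> g = \<iota> i \<cdot> h"
  shows "g = h"
proof -
  have fin: "finite (I - {i})" and notin: "i \<notin> I - {i}"
    and P: "is_coproduct C (insert i (I - {i})) T P \<iota>"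
    using assms(1-3) by (simp_all add: insert_absorb)
  obtain Q \<kappa> \<iota>2 where "is_binary_coproduct C (T i) Q P (\<iota> i) \<iota>2"
    using coproduct_split[OF fin notin P] by blast
  moreover obtain O' where "\<And>T \<iota>. is_coproduct C ({} :: nat set) T O' \<iota>" using initial_exists by blast
  ultimately show ?thesis using binary_coprojections(1) assms(4-6) by blast
qed

lemma coprojections_disjoint:
  fixes I :: "nat set"
  assumes I: "finite I" and P: "is_coproduct C I T P \<iota>" and ij: "i \<in> I" "j \<in> I" "i \<noteq> j"
    and gh: "g \<in> hom C Z (T i)" "h \<in> hom C Z (T j)" "\<iota> i \<cdot> g = \<iota> j \<cdot> h"
  shows "is_coproduct C ({} :: nat set) T' Z \<kappa>'"
proof -
  have fin: "finite (I - {i})" and notin: "i \<notin> I - {i}"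
    and P': "is_coproduct C (insert i (I - {i})) T P \<iota>"
    using I P ij by (simp_all add: insert_absorb)
  obtain Q \<kappa> \<iota>2 where Q: "is_coproduct C (I - {i}) T Q \<kappa>"
    "is_binary_coproduct C (T i) Q P (\<iota> i) \<iota>2" "\<And>j. j \<in> I - {i} \<Longrightarrow> \<iota>2 \<cdot> \<kappa> j = \<iota> j"
    using coproduct_split[OF fin notin P'] by blast
  obtain O' where O': "\<And>T \<iota>. is_coproduct C ({} :: nat set) T O' \<iota>" using initial_exists by blast
  have j: "j \<in> I - {i}" using ij by blast
  note k = coproduct_inj[OF Q(1) j]
  have "\<iota> i \<cdot> g = \<iota>2 \<cdot> (\<kappa> j \<cdot> h)"
    using gh(3) Q(3)[OF j] Comp_assoc[OF gh(2) k binary_coproductD(2)[OF Q(2)]] by simp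
  with binary_coprojections(2)[OF Q(2) O' gh(1) Comp_in_hom[OF gh(2) k]]
  obtain w where "w \<in> hom C Z O'" by blast
  then show ?thesis using initial_strict O' by blast
qed

lemma coprojection_pullback:
  fixes I :: "nat set"
  assumes "finite I" "is_coproduct C I T P \<iota>" "i \<in> I" "f \<in> hom C Z P"
  shows "\<exists>Q p q. is_pullback C Q (T i) Z P p q (\<iota> i) f"
proof -
  have "has_pullbacks_along_coprojections C" using extensive by (simp add: finitary_extensive_def)
  from this[unfolded has_pullbacks_along_coprojections_def, rule_format, OF conjI[OF assms(1,2)] assms(3,4)]
  show ?thesis .
qed

lemma pullback_along_binary_coprojections:
  assumes P: "is_binary_coproduct C X Y P \<iota>1 \<iota>2" and f: "f \<in> hom C Z P"
  obtains Z1 p1 q1 Z2 p2 q2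
  where "is_pullback C Z1 X Z P p1 q1 \<iota>1 f" "is_pullback C Z2 Y Z P p2 q2 \<iota>2 f"
proof -
  \<comment> \<open>The coproduct over the truth values becomes one over \<open>{0, 1}\<close>, with \<open>0\<close> for the first summand.\<close>
  let ?h = "\<lambda>n :: nat. n = 0"
  have h: "bij_betw ?h {0, 1} UNIV"
    by (rule bij_betwI[where g = "\<lambda>b. if b then 0 else 1"]) auto
  note P' = coproduct_reindex[OF h P[unfolded is_binary_coproduct_def]]
  have "\<exists>Q p q. is_pullback C Q ((case_bool X Y \<circ> ?h) n) Z P p q ((case_bool \<iota>1 \<iota>2 \<circ> ?h) n) f"
    if "n \<in> {0, 1}" for n
    by (rule coprojection_pullback[OF _ P' that f]) simp
  from this[of 0] this[of 1] show ?thesis using that by simp blast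
qed

text \<open>For two summands this is extensivity. The general case follows by splitting off one
  summand at a time; it ends with the empty coproduct, where it is strictness of the initial
  object.\<close>

lemma coproduct_pullback:
  fixes I :: "nat set"
  assumes "finite I" "is_coproduct C I T P \<iota>" "f \<in> hom C Z P"
  shows "\<exists>Y k p. is_coproduct C I Y Z k \<and>
    (\<forall>i\<in>I. p i \<in> hom C (Y i) (T i) \<and> \<iota> i \<cdot> p i = f \<cdot> k i)"
  using assms
proof (induction I arbitrary: P \<iota> f Z rule: finite_induct)
  case empty
  then show ?case using initial_strict by blast
next
  case (insert i I)
  obtain Q \<kappa> \<iota>2 where Q: "is_coproduct C I T Q \<kappa>"
    "is_binary_coproduct C (T i) Q P (\<iota> i) \<iota>2" "\<And>j. j \<in> I \<Longrightarrow> \<iota>2 \<cdot> \<kappa> j = \<iota> j"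
    using coproduct_split[OF insert.hyps insert.prems(1)] by blast
  obtain Z1 p1 q1 Z2 p2 q2 where pb: "is_pullback C Z1 (T i) Z P p1 q1 (\<iota> i) f"
    "is_pullback C Z2 Q Z P p2 q2 \<iota>2 f"
    using pullback_along_binary_coprojections[OF Q(2) insert.prems(2)] by blast
  have h: "p1 \<in> hom C Z1 (T i)" "q1 \<in> hom C Z1 Z" "\<iota> i \<cdot> p1 = f \<cdot> q1"
    "p2 \<in> hom C Z2 Q" "q2 \<in> hom C Z2 Z" "\<iota>2 \<cdot> p2 = f \<cdot> q2"
    using pb by (simp_all add: is_pullback_def)
  have B: "is_binary_coproduct C Z1 Z2 Z q1 q2"
    using extensive_iff[OF Q(2) h(2,5,1) insert.prems(2) h(4,3,6)] pb by simp
  from insert.IH[OF Q(1) h(4)] obtain Y p k where Y: "is_coproduct C I Y Z2 k"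
    and p: "\<And>j. j \<in> I \<Longrightarrow> p j \<in> hom C (Y j) (T j)" "\<And>j. j \<in> I \<Longrightarrow> \<kappa> j \<cdot> p j = p2 \<cdot> k j" by blast
  let ?Y = "Y(i := Z1)" and ?p = "p(i := p1)" and ?k = "\<lambda>j. if j = i then q1 else q2 \<cdot> k j"
  have "is_coproduct C I ?Y Z2 k"
    by (subst coproduct_cong[of _ _ Y _ k]) (use Y insert.hyps in auto)
  from coproduct_insert_iff[OF insert.hyps(2) this, of q1 Z q2]
  have "is_coproduct C (insert i I) ?Y Z ?k" using B h by simp
  moreover have "?p j \<in> hom C (?Y j) (T j)" "\<iota> j \<cdot> ?p j = f \<cdot> ?k j" if j: "j \<in> insert i I" for j
  proof -
    show "?p j \<in> hom C (?Y j) (T j)" using j p h by auto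
    show "\<iota> j \<cdot> ?p j = f \<cdot> ?k j"
    proof (cases "j = i")
      case False
      then have j: "j \<in> I" using j by simp
      note k = coproduct_inj[OF Y j] and \<kappa> = coproduct_inj[OF Q(1) j]
        and \<iota>2 = binary_coproductD(2)[OF Q(2)]
      have "\<iota> j \<cdot> p j = \<iota>2 \<cdot> (\<kappa> j \<cdot> p j)"
        using Comp_assoc[OF p(1)[OF j] \<kappa> \<iota>2] Q(3)[OF j] by simp
      also have "\<dots> = (f \<cdot> q2) \<cdot> k j"
        using p(2)[OF j] Comp_assoc[OF k h(4) \<iota>2] h(6) by simp
      also have "\<dots> = f \<cdot> (q2 \<cdot> k j)" using Comp_assoc[OF k h(5) insert.prems(2)] .
      finally show ?thesis using False by simp
    qed (use h in simp)
  qed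
  ultimately show ?case by blast
qed


section \<open>The topology of finite coproduct decompositions\<close>

definition decomposition_topology :: "'a \<Rightarrow> 'b set set" where
  "decomposition_topology X = {S. sieve C X S \<and>
    (\<exists>(I :: nat set) T \<iota>. finite I \<and> is_coproduct C I T X \<iota> \<and> \<iota> ` I \<subseteq> S)}"

lemma decomposition_topologyI:
  fixes I :: "nat set"
  assumes "sieve C X S" "finite I" "is_coproduct C I T X \<iota>" "\<iota> ` I \<subseteq> S"
  shows "S \<in> decomposition_topology X"
  using assms unfolding decomposition_topology_def by blast

lemma decomposition_topology_grothendieck: "grothendieck_topology C decomposition_topology"
  unfolding grothendieck_topology_def
proof (intro conjI ballI allI impI)
  show "sieve C X S" if "S \<in> decomposition_topology X" for X S
    using that by (simp add: decomposition_topology_def)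
next
  fix X assume X: "X \<in> Obj C"
  have "Ident C X \<in> maximal_sieve C X" using Ident_in_hom[OF X] by (simp add: maximal_sieve_def hom_def)
  then have "(\<lambda>_. Ident C X) ` {0::nat} \<subseteq> maximal_sieve C X" by simp
  then show "maximal_sieve C X \<in> decomposition_topology X"
    using decomposition_topologyI[OF sieve_maximal[OF X] _ coproduct_singleton[OF X, of "0::nat"]] by simp
next
  fix X Y S f assume f: "f \<in> hom C Y X" and "S \<in> decomposition_topology X"
  then obtain I :: "nat set" and T \<iota> where S: "sieve C X S" and I: "finite I"
    and P: "is_coproduct C I T X \<iota>" and \<iota>S: "\<iota> ` I \<subseteq> S"
    by (auto simp: decomposition_topology_def)
  obtain Z k p where k: "is_coproduct C I Z Y k"
    and kp: "\<And>i. i \<in> I \<Longrightarrow> p i \<in> hom C (Z i) (T i) \<and> \<iota> i \<cdot> p i = f \<cdot> k i"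
    using coproduct_pullback[OF I P f] by blast
  note p = kp[THEN conjunct1] kp[THEN conjunct2]
  have "k i \<in> pullback_sieve C f S" if i: "i \<in> I" for i
  proof -
    have "\<iota> i \<cdot> p i \<in> S" using sieve_Comp[OF S _ coproduct_inj[OF P i] p(1)[OF i]] \<iota>S i by blast
    then show ?thesis
      using p(2)[OF i] coproduct_inj[OF k i] f by (simp add: pullback_sieve_def hom_def)
  qed
  then have "k ` I \<subseteq> pullback_sieve C f S" by blast
  then show "pullback_sieve C f S \<in> decomposition_topology Y"
    by (rule decomposition_topologyI[OF sieve_pullback[OF f S] I k])
next
  fix X S R assume *: "S \<in> decomposition_topology X \<and> sieve C X R \<and>
    (\<forall>f\<in>S. pullback_sieve C f R \<in> decomposition_topology (Dom C f))"
  then obtain I :: "nat set" and T \<iota> where I: "finite I"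
    and P: "is_coproduct C I T X \<iota>" and \<iota>S: "\<iota> ` I \<subseteq> S"
    by (auto simp: decomposition_topology_def)
  have "\<exists>(K :: nat set) U \<kappa>. finite K \<and> is_coproduct C K U (T i) \<kappa> \<and> \<kappa> ` K \<subseteq> pullback_sieve C (\<iota> i) R"
    if i: "i \<in> I" for i
  proof -
    have "Dom C (\<iota> i) = T i" using coproduct_inj[OF P i] by (simp add: hom_def)
    then have "pullback_sieve C (\<iota> i) R \<in> decomposition_topology (T i)" using * \<iota>S i by force
    then show ?thesis by (simp add: decomposition_topology_def)
  qed
  then obtain K :: "nat \<Rightarrow> nat set" and U \<kappa> where K: "\<And>i. i \<in> I \<Longrightarrow> finite (K i)"
    "\<And>i. i \<in> I \<Longrightarrow> is_coproduct C (K i) (U i) (T i) (\<kappa> i)"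
    "\<And>i. i \<in> I \<Longrightarrow> \<kappa> i ` K i \<subseteq> pullback_sieve C (\<iota> i) R" by metis
  let ?U = "\<lambda>(i, j). U i j" and ?\<kappa> = "\<lambda>(i, j). \<iota> i \<cdot> \<kappa> i j"
  have P': "is_coproduct C (Sigma I K) ?U X ?\<kappa>"
    using coproduct_Sigma[where A = I and Q = T and \<iota> = \<iota>, OF K(2) coproduct_inj[OF P]] P by simp
  have "finite (Sigma I K)" using I K(1) by simp
  then obtain h where h: "bij_betw h {0..<card (Sigma I K)} (Sigma I K)"
    using ex_bij_betw_nat_finite by blast
  have "?\<kappa> ij \<in> R" if "ij \<in> Sigma I K" for ij
    using that K(3) by (auto simp: pullback_sieve_def)
  then have "?\<kappa> ` Sigma I K \<subseteq> R" by blast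
  then have "(?\<kappa> \<circ> h) ` {0..<card (Sigma I K)} \<subseteq> R"
    unfolding image_comp[symmetric] bij_betw_imp_surj_on[OF h] .
  then show "R \<in> decomposition_topology X"
    using decomposition_topologyI[OF _ finite_atLeastLessThan coproduct_reindex[OF h P']] * by blast
qed

text \<open>Projectivity of \<open>B\<close> splits the epimorphism \<open>q\<close> from the coproduct of the \<open>X i\<close> onto \<open>B\<close>.
  Pulling that coproduct back along a section of \<open>q\<close> decomposes \<open>B\<close> into summands on which
  the section, hence also the identity of \<open>B\<close>, factors through one of the \<open>X i\<close>.\<close>

lemma generated_sieve_in_decomposition_topology:
  fixes I :: "nat set"
  assumes I: "finite I" and f: "effective_epi_family C I X B f" and B: "projective C B"
  shows "generated_sieve C I X f \<in> decomposition_topology B"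
proof -
  have fi: "f i \<in> hom C (X i) B" if "i \<in> I" for i
    using f that by (simp add: effective_epi_family_def)
  have Bo: "B \<in> Obj C" using f by (simp add: effective_epi_family_def)
  have "X i \<in> Obj C" if "i \<in> I" for i using fi[OF that] hom_Obj by blast
  then obtain Q \<kappa> where Q: "is_coproduct C I X Q \<kappa>" using finite_coproduct_exists[OF I] by metis
  obtain q where q: "q \<in> hom C Q B" "\<And>i. i \<in> I \<Longrightarrow> q \<cdot> \<kappa> i = f i"
    using coproduct_desc[OF Q Bo fi] by blast
  have "epimorphism C Q B q"
    unfolding epimorphism_def
  proof (intro conjI allI ballI impI q(1))
    fix W d d' assume d: "d \<in> hom C B W" "d' \<in> hom C B W" and eq: "d \<cdot> q = d' \<cdot> q"
    have df: "d' \<cdot> f i = d \<cdot> f i" if i: "i \<in> I" for i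
    proof -
      note k = coproduct_inj[OF Q i]
      show ?thesis
        using Comp_assoc[OF k q(1) d(1)] Comp_assoc[OF k q(1) d(2)] eq q(2)[OF i] by simp
    qed
    have cocone: "\<forall>i\<in>I. d \<cdot> f i \<in> hom C (X i) W" using fi d Comp_in_hom by blast
    have "(d \<cdot> f i) \<cdot> gi = (d \<cdot> f j) \<cdot> gj"
      if "i \<in> I" "j \<in> I" "gi \<in> hom C Z (X i)" "gj \<in> hom C Z (X j)" "f i \<cdot> gi = f j \<cdot> gj" for i j Z gi gj
      using Comp_assoc[OF that(3) fi[OF that(1)] d(1)] Comp_assoc[OF that(4) fi[OF that(2)] d(1)] that(5)
      by simp
    then have "\<exists>!k. k \<in> hom C B W \<and> (\<forall>i\<in>I. k \<cdot> f i = d \<cdot> f i)"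
      using f[unfolded effective_epi_family_def, THEN conjunct2, THEN conjunct2, rule_format,
          of W "\<lambda>i. d \<cdot> f i"] cocone hom_Obj[OF d(1)] by blast
    then show "d = d'" using d df by metis
  qed
  then obtain \<sigma> where \<sigma>: "\<sigma> \<in> hom C B Q" "q \<cdot> \<sigma> = Ident C B"
    using B Ident_in_hom[OF Bo] unfolding projective_def by blast
  obtain Y k p where k: "is_coproduct C I Y B k"
    and kp: "\<And>i. i \<in> I \<Longrightarrow> p i \<in> hom C (Y i) (X i) \<and> \<kappa> i \<cdot> p i = \<sigma> \<cdot> k i"
    using coproduct_pullback[OF I Q \<sigma>(1)] by blast
  note p = kp[THEN conjunct1] kp[THEN conjunct2]
  have "k i \<in> generated_sieve C I X f" if i: "i \<in> I" for i
  proof -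
    note ki = coproduct_inj[OF k i] and \<kappa>i = coproduct_inj[OF Q i]
    have "k i = q \<cdot> (\<sigma> \<cdot> k i)" using Comp_assoc[OF ki \<sigma>(1) q(1)] \<sigma>(2) Ident_Comp[OF ki] by simp
    also have "\<dots> = f i \<cdot> p i"
      using p(2)[OF i] Comp_assoc[OF p(1)[OF i] \<kappa>i q(1)] q(2)[OF i] by simp
    finally show ?thesis using p(1)[OF i] i by (auto simp: generated_sieve_def hom_def)
  qed
  then have "k ` I \<subseteq> generated_sieve C I X f" by blast
  then show ?thesis
    by (rule decomposition_topologyI[OF sieve_generated[OF f] I k])
qed

end


section \<open>Sheaves and product-preserving presheaves\<close>

locale presheaf_on_extensive = extensive_category C + presheaf C F
  for C :: "('o, 'm) category" (structure) and F :: "('o, 'm, 'x) presheaf"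
begin

text \<open>A compatible family is determined by its values on the coprojections of a decomposition that
  belong to the sieve, and preservation of products glues these values. That the result restricts
  correctly along any \<open>f\<close> in the sieve can be tested on the summands of the domain of \<open>f\<close> obtained
  by pulling back the decomposition.\<close>

lemma product_preserving_sheaf:
  assumes F: "preserves_finite_products C F"
  shows "is_sheaf C decomposition_topology F"
  unfolding is_sheaf_def
proof (intro ballI allI impI)
  fix X S x
  assume X: "X \<in> Obj C" and "S \<in> decomposition_topology X" and x: "compatible_family C F S x"
  then obtain I :: "nat set" and T \<iota> where S: "sieve C X S" and I: "finite I"
    and P: "is_coproduct C I T X \<iota>" and \<iota>S: "\<iota> ` I \<subseteq> S"
    by (auto simp: decomposition_topology_def)
  have bij: "bij_betw (\<lambda>s. \<lambda>i\<in>I. Res F (k i) s) (Sec F Y) (\<Pi>\<^sub>E i\<in>I. Sec F (U i))"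
    if "is_coproduct C I U Y k" for U Y k
    using F I that coproduct_inj[OF that] hom_Obj unfolding preserves_finite_products_def by blast
  have ext: "s = s'" if k: "is_coproduct C I U Y k" and s: "s \<in> Sec F Y" "s' \<in> Sec F Y"
    and eq: "\<And>i. i \<in> I \<Longrightarrow> Res F (k i) s = Res F (k i) s'" for U Y k s s'
    using bij[OF k] s eq unfolding bij_betw_def
    by (meson inj_onD restrict_ext)
  have \<iota>: "\<iota> i \<in> hom C (T i) X" if "i \<in> I" for i using coproduct_inj[OF P that] .
  have xS: "x f \<in> Sec F Y" if "f \<in> S" "f \<in> hom C Y X" for f Y
    using x that unfolding compatible_family_def hom_def by blast
  have xg: "x (f \<cdot> g) = Res F g (x f)" if "f \<in> S" "f \<in> hom C Y X" "g \<in> hom C Z Y" for f g Y Z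
    using x that unfolding compatible_family_def hom_def by blast
  have "(\<lambda>i\<in>I. x (\<iota> i)) \<in> (\<Pi>\<^sub>E i\<in>I. Sec F (T i))" using \<iota>S \<iota> xS by auto
  then obtain s where s: "s \<in> Sec F X" and "(\<lambda>i\<in>I. Res F (\<iota> i) s) = (\<lambda>i\<in>I. x (\<iota> i))"
    using bij[OF P] unfolding bij_betw_def by (metis (no_types, lifting) imageE)
  then have s\<iota>: "Res F (\<iota> i) s = x (\<iota> i)" if "i \<in> I" for i using that by (metis restrict_apply')
  show "\<exists>!s. s \<in> Sec F X \<and> (\<forall>f\<in>S. Res F f s = x f)"
  proof (intro ex1I[of _ s] conjI ballI s)
    fix f assume fS: "f \<in> S"
    then have f: "f \<in> hom C (Dom C f) X" using S by (auto simp: sieve_def hom_def)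
    obtain Y k p where k: "is_coproduct C I Y (Dom C f) k"
      and kp: "\<And>i. i \<in> I \<Longrightarrow> p i \<in> hom C (Y i) (T i) \<and> \<iota> i \<cdot> p i = f \<cdot> k i"
      using coproduct_pullback[OF I P f] by blast
    note p = kp[THEN conjunct1] kp[THEN conjunct2]
    show "Res F f s = x f"
    proof (rule ext[OF k Res_in_Sec[OF f s] xS[OF fS f]])
      fix i assume i: "i \<in> I"
      note ki = coproduct_inj[OF k i]
      have "Res F (k i) (Res F f s) = Res F (\<iota> i \<cdot> p i) s" using Res_Comp[OF ki f s] p(2)[OF i] by simp
      also have "\<dots> = Res F (p i) (x (\<iota> i))" using Res_Comp[OF p(1)[OF i] \<iota>[OF i] s] s\<iota>[OF i] by simp
      also have "\<dots> = x (f \<cdot> k i)" using xg[OF _ \<iota>[OF i] p(1)[OF i]] \<iota>S i p(2)[OF i] by force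
      also have "\<dots> = Res F (k i) (x f)" using xg[OF fS f ki] .
      finally show "Res F (k i) (Res F f s) = Res F (k i) (x f)" .
    qed
  next
    fix s' assume s': "s' \<in> Sec F X \<and> (\<forall>f\<in>S. Res F f s' = x f)"
    show "s' = s" by (rule ext[OF P]) (use s' s s\<iota> \<iota>S in auto)
  qed
qed

lemma sheaf_initial:
  assumes F: "is_sheaf C (coherent_topology C) F"
    and Z: "is_coproduct C ({} :: nat set) T Z \<kappa>"
    and s: "s \<in> Sec F Z" "s' \<in> Sec F Z"
  shows "s = s'"
proof -
  \<comment> \<open>The empty family is effective epimorphic on an initial object, so the empty sieve covers it.\<close>
  have "generated_sieve C {} T \<kappa> \<in> coherent_topology C Z"
    using generated_sieve_in_coherent_topology[OF _ coproduct_effective_epi_family[OF Z]] by simp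
  moreover have "Z \<in> Obj C" using Z by (simp add: is_coproduct_def)
  moreover have "compatible_family C F (generated_sieve C {} T \<kappa>) undefined"
    by (simp add: compatible_family_def generated_sieve_def)
  ultimately have "\<exists>!s. s \<in> Sec F Z \<and> (\<forall>f\<in>generated_sieve C {} T \<kappa>. Res F f s = undefined f)"
    using F unfolding is_sheaf_def by blast
  then show ?thesis using s by (auto simp: generated_sieve_def)
qed

text \<open>The coprojections generate a covering sieve, so a section over \<open>P\<close> is a compatible family on
  that sieve. Compatibility imposes nothing on the values at the coprojections: these are
  monomorphisms, and two different ones agree only on initial objects, over which \<open>F\<close> has just one
  section.\<close>

lemma sheaf_product_preserving:
  assumes F: "is_sheaf C (coherent_topology C) F"
  shows "preserves_finite_products C F"
  unfolding preserves_finite_products_def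
proof (intro allI impI)
  fix I :: "nat set" and T P \<iota>
  assume "finite I \<and> (\<forall>i\<in>I. T i \<in> Obj C) \<and> is_coproduct C I T P \<iota>"
  then have I: "finite I" and P: "is_coproduct C I T P \<iota>" by auto
  have \<iota>: "\<iota> i \<in> hom C (T i) P" if "i \<in> I" for i using coproduct_inj[OF P that] .
  have Po: "P \<in> Obj C" using P by (simp add: is_coproduct_def)
  let ?S = "generated_sieve C I T \<iota>"
  note epi = coproduct_effective_epi_family[OF P]
  have glue: "\<exists>!s. s \<in> Sec F P \<and> (\<forall>f\<in>?S. Res F f s = x f)" if "compatible_family C F ?S x" for x
    using F Po generated_sieve_in_coherent_topology[OF I epi] that unfolding is_sheaf_def by blast
  have inS: "\<iota> i \<cdot> g \<in> ?S" if "i \<in> I" "g \<in> hom C Z (T i)" for i g Z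
    using that by (auto simp: generated_sieve_def hom_def)
  have S: "\<exists>i g. i \<in> I \<and> g \<in> hom C (Dom C k) (T i) \<and> k = \<iota> i \<cdot> g" if k: "k \<in> ?S" for k
  proof -
    obtain i g where ig: "k = \<iota> i \<cdot> g" "i \<in> I" "g \<in> hom C (Dom C g) (T i)"
      using k by (auto simp: generated_sieve_def hom_def)
    then have "Dom C k = Dom C g" using Comp_in_hom[OF ig(3) \<iota>[OF ig(2)]] by (simp add: hom_def)
    then show ?thesis using ig by metis
  qed
  have inj: "inj_on (\<lambda>s. \<lambda>i\<in>I. Res F (\<iota> i) s) (Sec F P)"
  proof (rule inj_onI)
    fix s s' assume s: "s \<in> Sec F P" "s' \<in> Sec F P"
      and "(\<lambda>i\<in>I. Res F (\<iota> i) s) = (\<lambda>i\<in>I. Res F (\<iota> i) s')"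
    then have eq: "Res F (\<iota> i) s' = Res F (\<iota> i) s" if "i \<in> I" for i using that by (metis restrict_apply')
    have Sh: "k \<in> hom C (Dom C k) P" if "k \<in> ?S" for k
      using sieve_generated[OF epi] that by (auto simp: sieve_def hom_def)
    have "compatible_family C F ?S (\<lambda>k. Res F k s)"
      unfolding compatible_family_def using Sh Res_in_Sec s Res_Comp by blast
    moreover have "Res F k s' = Res F k s" if "k \<in> ?S" for k
    proof -
      obtain i g where ig: "i \<in> I" "g \<in> hom C (Dom C k) (T i)" "k = \<iota> i \<cdot> g" using S[OF \<open>k \<in> ?S\<close>] by blast
      then show ?thesis
        using Res_Comp[OF ig(2) \<iota>[OF ig(1)] s(1)] Res_Comp[OF ig(2) \<iota>[OF ig(1)] s(2)] eq by simp
    qed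
    ultimately show "s = s'" using glue[of "\<lambda>k. Res F k s"] s by blast
  qed
  have surj: "\<exists>s\<in>Sec F P. (\<lambda>i\<in>I. Res F (\<iota> i) s) = t" if t: "t \<in> (\<Pi>\<^sub>E i\<in>I. Sec F (T i))" for t
  proof -
    have ti: "t i \<in> Sec F (T i)" if "i \<in> I" for i using t that by blast
    have wd: "Res F g (t i) = Res F h (t j)"
      if ij: "i \<in> I" "j \<in> I" and gh: "g \<in> hom C Z (T i)" "h \<in> hom C Z (T j)" "\<iota> i \<cdot> g = \<iota> j \<cdot> h"
      for i j g h Z
    proof (cases "i = j")
      case True
      then show ?thesis using coprojection_mono[OF I P ij(1)] gh by blast
    next
      case False
      then show ?thesis
        using sheaf_initial[OF F coprojections_disjoint[OF I P ij False gh]]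
          Res_in_Sec[OF gh(1) ti[OF ij(1)]] Res_in_Sec[OF gh(2) ti[OF ij(2)]] by blast
    qed
    \<comment> \<open>The factorization of \<open>k\<close> through a coprojection may be chosen, by \<open>wd\<close>.\<close>
    define x where "x k = (SOME y. \<exists>i g. i \<in> I \<and> g \<in> hom C (Dom C k) (T i) \<and> k = \<iota> i \<cdot> g \<and>
      y = Res F g (t i))" for k
    have x: "x (\<iota> i \<cdot> g) = Res F g (t i)" if ig: "i \<in> I" "g \<in> hom C Z (T i)" for i g Z
      unfolding x_def
    proof (rule someI2)
      have D: "Dom C (\<iota> i \<cdot> g) = Z" using Comp_in_hom[OF ig(2) \<iota>[OF ig(1)]] by (simp add: hom_def)
      show "\<exists>i' g'. i' \<in> I \<and> g' \<in> hom C (Dom C (\<iota> i \<cdot> g)) (T i') \<and> \<iota> i \<cdot> g = \<iota> i' \<cdot> g' \<and>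
        Res F g (t i) = Res F g' (t i')" using ig D by blast
      show "y = Res F g (t i)" if "\<exists>i' g'. i' \<in> I \<and> g' \<in> hom C (Dom C (\<iota> i \<cdot> g)) (T i') \<and>
        \<iota> i \<cdot> g = \<iota> i' \<cdot> g' \<and> y = Res F g' (t i')" for y
        using that wd[OF ig(1) _ ig(2)] D by metis
    qed
    have "compatible_family C F ?S x"
      unfolding compatible_family_def
    proof (intro conjI ballI allI)
      fix k assume "k \<in> ?S"
      then obtain i g where ig: "i \<in> I" "g \<in> hom C (Dom C k) (T i)" "k = \<iota> i \<cdot> g" using S by blast
      have xk: "x k = Res F g (t i)" using x[OF ig(1,2)] ig(3) by simp
      then show "x k \<in> Sec F (Dom C k)" using Res_in_Sec[OF ig(2) ti[OF ig(1)]] by simp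
      fix Z h assume h: "h \<in> hom C Z (Dom C k)"
      have "x (k \<cdot> h) = Res F (g \<cdot> h) (t i)"
        using x[OF ig(1) Comp_in_hom[OF h ig(2)]] Comp_assoc[OF h ig(2) \<iota>[OF ig(1)]] ig(3) by simp
      then show "x (k \<cdot> h) = Res F h (x k)" using Res_Comp[OF h ig(2) ti[OF ig(1)]] xk by simp
    qed
    then obtain s where s: "s \<in> Sec F P" "\<And>f. f \<in> ?S \<Longrightarrow> Res F f s = x f" using glue by blast
    have "Res F (\<iota> i) s = t i" if i: "i \<in> I" for i
    proof -
      have Ti: "T i \<in> Obj C" using \<iota>[OF i] hom_Obj by blast
      note id = Ident_in_hom[OF Ti]
      have "Res F (\<iota> i) s = x (\<iota> i \<cdot> Ident C (T i))"
        using s(2)[OF inS[OF i id]] Comp_Ident[OF \<iota>[OF i]] by simp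
      then show ?thesis using x[OF i id] Res_Ident[OF Ti ti[OF i]] by simp
    qed
    then have "(\<lambda>i\<in>I. Res F (\<iota> i) s) = t" using t by (auto simp: PiE_def extensional_def)
    then show ?thesis using s(1) by blast
  qed
  have "(\<lambda>i\<in>I. Res F (\<iota> i) s) \<in> (\<Pi>\<^sub>E i\<in>I. Sec F (T i))" if "s \<in> Sec F P" for s
    using Res_in_Sec[OF \<iota> that] by auto
  then show "bij_betw (\<lambda>s. \<lambda>i\<in>I. Res F (\<iota> i) s) (Sec F P) (\<Pi>\<^sub>E i\<in>I. Sec F (T i))"
    using inj surj unfolding bij_betw_def by fast
qed

end

theorem proposition6p14:
  fixes C :: "('o, 'm) category" and F :: "('o, 'm, 'x) presheaf"
  assumes "category C"
    and "preregular C"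
    and "finitary_extensive C"
    and "\<forall>X\<in>Obj C. projective C X"
    and "presheaf C F"
  shows "is_sheaf C (coherent_topology C) F \<longleftrightarrow> preserves_finite_products C F"
proof -
  interpret presheaf C F by fact
  interpret presheaf_on_extensive C F by unfold_locales fact
  have "coherent_topology C \<le> decomposition_topology"
  proof (rule coherent_topology_least[OF decomposition_topology_grothendieck])
    fix I :: "nat set" and X B f
    assume "finite I" and f: "effective_epi_family C I X B f"
    moreover have "projective C B" using f assms(4) by (simp add: effective_epi_family_def)
    ultimately show "generated_sieve C I X f \<in> decomposition_topology B"
      by (rule generated_sieve_in_decomposition_topology)
  qed
  then have "is_sheaf C (coherent_topology C) F" if "is_sheaf C decomposition_topology F"
    using that unfolding is_sheaf_def le_fun_def by blast
  then show ?thesis using product_preserving_sheaf sheaf_product_preserving by blast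
qed

end
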